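(* Let $P(x)$ be an $r \times r$ polynomial matrix ($r\ge 2$) in $n$ variables and of degree $2d$. Then $P(x)$ admits a decomposition $$ P(x) = \sum_{1 \leq i < j \leq r} E^{\mathsf T}_{ij} P_{ij}(x)E_{ij},\qquad \text{with each } P_{ij}(x) \text{ a } 2\times 2 \text{ SOS matrix}, $$ if and only if $$ P(x) = \left(I_r \otimes v_d(x)\right)^{\mathsf T} Q \left(I_r \otimes v_d(x)\right) $$ for some $Q \in \mathcal{FW}^{rN}_{\alpha,2}$, where $N = {n+d \choose d}$ and $\alpha$ is the homogeneous partition $\alpha = \{\underbrace{N,N,\ldots, N}_{r}\}$ of $rN$.
   Context: $E_i\in\mathbb{R}^{1\times r}$ is the $i$-th row of $I_r$ and $E_{ij}=\begin{bmatrix}E_i^{\mathsf T} & E_j^{\mathsf T}\end{bmatrix}^{\mathsf T}\in\mathbb{R}^{2\times r}$. A real polynomial matrix $R(x)$ of size $m\times m$ is an SOS matrix if $R(x)=M(x)^{\mathsf T}M(x)$ for some polynomial matrix $M(x)$ of size $s\times m$ for some $s$. "Degree $2d$" means that the entries of $P$ have degree at most $2d$. $v_d(x) = [ 1,x_1,\ldots,x_n,x_1^2,x_1x_2,\ldots,x_n^d ]^{\mathsf T}$ is the vector of all $N$ monomials in $x\in\mathbb{R}^n$ of degree at most $d$, and $\otimes$ is the Kronecker product. For a partition $\alpha=\{k_1,\ldots,k_p\}$ of $m$ (positive integers summing to $m$, $p\ge 2$), let $E_i^\alpha\in\mathbb{R}^{k_i\times m}$ be the $i$-th block row of $I_m$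 when the rows of $I_m$ are split consecutively into blocks of sizes $k_1,\ldots,k_p$, and $E_{ij}^\alpha=\begin{bmatrix}(E_i^\alpha)^{\mathsf T} & (E_j^\alpha)^{\mathsf T}\end{bmatrix}^{\mathsf T}$. The set $\mathcal{FW}_{\alpha,2}^m$ consists of all symmetric $Z\in\mathbb{R}^{m\times m}$ of the form $Z=\sum_{1\le i<j\le p} (E^{\alpha}_{ij})^{\mathsf T} X_{ij} E^{\alpha}_{ij}$ for some PSD matrices $X_{ij}\in\mathbb{S}^{k_i+k_j}_+$. *)

theory Defs
  imports "Jordan_Normal_Form.Matrix" "HOL-Library.Poly_Mapping"
begin

section \<open>Real polynomials in $n$ variables\<close>

text \<open>Exponents are finitely supported functions \<^typ>\<open>nat \<Rightarrow>\<^sub>0 nat\<close>; the variable $x_{i+1}$ has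
  index $i$, so that polynomials in $x_1,\dots,x_n$ only use the indices below $n$.\<close>

type_synonym rpoly = "(nat \<Rightarrow>\<^sub>0 nat) \<Rightarrow>\<^sub>0 real"

definition polys :: "nat \<Rightarrow> rpoly set" where
  "polys n = {p. \<forall>e \<in> Poly_Mapping.keys p. Poly_Mapping.keys e \<subseteq> {..<n}}"

definition exp_degree :: "(nat \<Rightarrow>\<^sub>0 nat) \<Rightarrow> nat" where
  "exp_degree e = (\<Sum>i\<in>Poly_Mapping.keys e. Poly_Mapping.lookup e i)"

definition polys_le :: "nat \<Rightarrow> nat \<Rightarrow> rpoly set" where
  "polys_le n D = {p \<in> polys n. \<forall>e \<in> Poly_Mapping.keys p. exp_degree e \<le> D}"

abbreviation const_poly :: "real \<Rightarrow> rpoly" where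
  "const_poly c \<equiv> Poly_Mapping.single 0 c"

definition monomial :: "nat list \<Rightarrow> rpoly" where
  "monomial es = Poly_Mapping.single (Poly_Mapping.nth es) 1"

text \<open>Exponent tuples of length $n$ and sum $k$, with larger powers of earlier variables first:
  $x_1^2, x_1x_2, \dots$\<close>

fun exponents :: "nat \<Rightarrow> nat \<Rightarrow> nat list list" where
  "exponents 0 k = (if k = 0 then [[]] else [])"
| "exponents (Suc n) k = concat (map (\<lambda>a. map ((#) a) (exponents n (k - a))) (rev [0..<Suc k]))"

definition exponents_le :: "nat \<Rightarrow> nat \<Rightarrow> nat list list" where
  "exponents_le n d = concat (map (exponents n) [0..<Suc d])"

lemma set_exponents: "set (exponents n k) = {es. length es = n \<and> sum_list es = k}"
proof (induction n arbitrary: k)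
  case 0
  show ?case by auto
next
  case (Suc n)
  show ?case
  proof (intro Set.set_eqI iffI)
    fix es assume "es \<in> set (exponents (Suc n) k)"
    then show "es \<in> {es. length es = Suc n \<and> sum_list es = k}"
      by (auto simp: Suc simp del: upt_Suc)
  next
    fix es assume "es \<in> {es. length es = Suc n \<and> sum_list es = k}"
    then obtain a fs where "es = a # fs" "length fs = n" "a + sum_list fs = k"
      by (cases es) auto
    then show "es \<in> set (exponents (Suc n) k)"
      by (auto simp: Suc simp del: upt_Suc intro!: bexI[of _ a])
  qed
qed

lemma set_exponents_le: "set (exponents_le n d) = {es. length es = n \<and> sum_list es \<le> d}"
  by (auto simp: exponents_le_def set_exponents simp del: upt_Suc)

lemma distinct_exponents: "distinct (exponents n k)"
proof (induction n arbitrary: k)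
  case 0
  show ?case by simp
next
  case (Suc n)
  have gen: "distinct (concat (map (\<lambda>a. map ((#) a) (exponents n (k - a))) as))"
    if "distinct as" for as :: "nat list"
    using that by (induction as) (auto simp: distinct_map Suc)
  show ?case unfolding exponents.simps by (rule gen) simp
qed

lemma distinct_exponents_le: "distinct (exponents_le n d)"
proof -
  have gen: "distinct (concat (map (exponents n) ks))" if "distinct ks" for ks
    using that by (induction ks) (auto simp: distinct_exponents set_exponents)
  show ?thesis unfolding exponents_le_def by (rule gen) simp
qed

lemma length_exponents_le: "length (exponents_le n d) = (n + d) choose d"
proof -
  have len: "length (exponents n k) = (k + n - 1) choose k" for k
  proof -
    have "length (exponents n k) = card {es. length es = n \<and> sum_list es = k}"
      using distinct_card[OF distinct_exponents, of n k] by (simp add: set_exponents)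
    then show ?thesis by (simp add: card_length_sum_list)
  qed
  have "length (exponents_le n d) = (\<Sum>k\<leftarrow>[0..<Suc d]. (k + n - 1) choose k)"
    by (simp add: exponents_le_def length_concat o_def len del: upt_Suc)
  also have "\<dots> = (\<Sum>k\<le>d. (k + n - 1) choose k)"
    by (simp add: interv_sum_list_conv_sum_set_nat atLeast0LessThan lessThan_Suc_atMost del: upt_Suc)
  also have "\<dots> = (n + d) choose d"
  proof (cases n)
    case 0
    have "(\<Sum>k\<le>d. (k - 1) choose k) = (\<Sum>k\<le>d. if k = 0 then 1 else 0)"
      by (rule sum.cong) (auto simp: binomial_eq_0)
    then show ?thesis using 0 by simp
  next
    case (Suc m)
    then show ?thesis using sum_choose_lower[of m d] by (simp add: add.commute)
  qed
  finally show ?thesis .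
qed

lemma "exponents_le 2 2 = [[0, 0], [1, 0], [0, 1], [2, 0], [1, 1], [0, 2]]"
  by (simp add: exponents_le_def numeral_2_eq_2 upt_rec)

text \<open>The column $v_d(x) = [1, x_1, \dots, x_n, x_1^2, x_1x_2, \dots, x_n^d]^{\mathsf T}$.\<close>

definition monomial_col :: "nat \<Rightarrow> nat \<Rightarrow> rpoly mat" where
  "monomial_col n d =
     mat (length (exponents_le n d)) 1 (\<lambda>(i, _). monomial (exponents_le n d ! i))"


section \<open>Matrices\<close>

definition mat_sum :: "nat \<Rightarrow> nat \<Rightarrow> ('i \<Rightarrow> 'a :: comm_monoid_add mat) \<Rightarrow> 'i set \<Rightarrow> 'a mat" where
  "mat_sum nr nc f I = mat nr nc (\<lambda>ab. \<Sum>i\<in>I. f i $$ ab)"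

definition kronecker :: "'a :: times mat \<Rightarrow> 'a mat \<Rightarrow> 'a mat" (infixl \<open>\<otimes>\<^sub>K\<close> 70) where
  "A \<otimes>\<^sub>K B = mat (dim_row A * dim_row B) (dim_col A * dim_col B)
     (\<lambda>(i, j). A $$ (i div dim_row B, j div dim_col B) * B $$ (i mod dim_row B, j mod dim_col B))"

definition psd_mats :: "nat \<Rightarrow> real mat set" where
  "psd_mats k = {X \<in> carrier_mat k k. X\<^sup>T = X \<and> (\<forall>v \<in> carrier_vec k. 0 \<le> v \<bullet> (X *\<^sub>v v))}"

definition poly_mats :: "nat \<Rightarrow> nat \<Rightarrow> nat \<Rightarrow> rpoly mat set" where
  "poly_mats n nr nc = {M \<in> carrier_mat nr nc. elements_mat M \<subseteq> polys n}"

definition sos_mats :: "nat \<Rightarrow> nat \<Rightarrow> rpoly mat set" where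
  "sos_mats n m = {R \<in> poly_mats n m m. \<exists>s. \<exists>M \<in> poly_mats n s m. R = M\<^sup>T * M}"

definition index_pairs :: "nat \<Rightarrow> (nat \<times> nat) set" where
  "index_pairs p = {(i, j). i < j \<and> j < p}"

text \<open>The matrices $E_i$ and $E_{ij}$ (rows are numbered from 0).\<close>

definition E_row :: "nat \<Rightarrow> nat \<Rightarrow> 'a :: {zero, one} mat" where
  "E_row r i = mat_of_row (row (1\<^sub>m r) i)"

definition E_pair :: "nat \<Rightarrow> nat \<Rightarrow> nat \<Rightarrow> 'a :: {zero, one} mat" where
  "E_pair r i j = E_row r i @\<^sub>r E_row r j"


section \<open>Block factor-width-two matrices\<close>

definition is_partition :: "nat \<Rightarrow> nat list \<Rightarrow> bool" where
  "is_partition m \<alpha> \<longleftrightarrow> length \<alpha> \<ge> 2 \<and> (\<forall>k \<in> set \<alpha>. k > 0) \<and> sum_list \<alpha> = m"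

definition E_block :: "nat \<Rightarrow> nat list \<Rightarrow> nat \<Rightarrow> 'a :: {zero, one} mat" where
  "E_block m \<alpha> i = mat (\<alpha> ! i) m (\<lambda>(a, b). 1\<^sub>m m $$ (sum_list (take i \<alpha>) + a, b))"

definition E_block_pair :: "nat \<Rightarrow> nat list \<Rightarrow> nat \<Rightarrow> nat \<Rightarrow> 'a :: {zero, one} mat" where
  "E_block_pair m \<alpha> i j = E_block m \<alpha> i @\<^sub>r E_block m \<alpha> j"

text \<open>This is meant for \<^term>\<open>is_partition m \<alpha>\<close>.\<close>

definition FW2 :: "nat \<Rightarrow> nat list \<Rightarrow> real mat set" where
  "FW2 m \<alpha> = {Z \<in> carrier_mat m m. Z\<^sup>T = Z \<and>
     (\<exists>X :: nat \<Rightarrow> nat \<Rightarrow> real mat.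
        (\<forall>(i, j) \<in> index_pairs (length \<alpha>). X i j \<in> psd_mats (\<alpha> ! i + \<alpha> ! j)) \<and>
        Z = mat_sum m m (\<lambda>(i, j). (E_block_pair m \<alpha> i j)\<^sup>T * X i j * E_block_pair m \<alpha> i j)
              (index_pairs (length \<alpha>)))}"

lemma is_partition_replicate:
  "r \<ge> 2 \<Longrightarrow> is_partition (r * ((n + d) choose d)) (replicate r ((n + d) choose d))"
  by (auto simp: is_partition_def sum_list_replicate)

end

(* With v the column of monomials, E_ij^alpha (I_r (x) v) = (I_2 (x) v) E_ij, so conjugating a block
   factor-width-two matrix by I_r (x) v gives the sum of the E_ij^T ((I_2 (x) v)^T X_ij (I_2 (x) v)) E_ij,
   and the statement reduces to Gram representations of the 2 x 2 blocks. The Gram matrix X_ij of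
   an SOS block M^T M exists because M has degree at most d: each diagonal entry of P is the sum of
   all squared entries of the columns meeting it, and in a sum of real squares the leading terms
   cannot cancel. *)
theory Submission
  imports Defs
begin

text \<open>The hypothesis bounds the degree of \<open>P\<close> alone; nothing bounds the blocks of
  a given decomposition. An off-diagonal entry of \<open>P\<close> comes from a single block, but a
  diagonal one collects contributions from several, and that is where terms of high degree might
  disappear. Hence the degree bound is proved for the entries of all factors at once, not block by
  block. The exponent that excludes this is extreme in a graded order: total degree first, ties
  broken by the linear order on exponents. That linear order is compatible with addition, but on its
  own does not respect the degree. For the converse a PSD matrix has to be written as
  \<open>L\<^sup>T * L\<close>, which is done by completing the square in the last coordinate. The
  matrices \<open>E_block_pair\<close> occur with real entries in \<open>FW2\<close> and with
  polynomial entries in the congruence; \<open>const_poly\<close> carries the first kind into the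
  second.\<close>

section \<open>Degrees of exponents and coefficients of squares\<close>

lemma exp_degree_superset:
  assumes "finite I" "Poly_Mapping.keys e \<subseteq> I"
  shows "exp_degree e = (\<Sum>i\<in>I. Poly_Mapping.lookup e i)"
  unfolding exp_degree_def by (rule sum.mono_neutral_left) (use assms in \<open>auto simp: in_keys_iff\<close>)

lemma exp_degree_add: "exp_degree (a + b) = exp_degree a + exp_degree b"
proof -
  let ?I = "Poly_Mapping.keys a \<union> Poly_Mapping.keys b"
  have "exp_degree (a + b) = (\<Sum>i\<in>?I. Poly_Mapping.lookup (a + b) i)"
    by (rule exp_degree_superset) (simp_all add: Poly_Mapping.keys_add)
  also have "\<dots> = exp_degree a + exp_degree b"
    by (simp add: lookup_add sum.distrib exp_degree_superset[of ?I])
  finally show ?thesis .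
qed

text \<open>Replaces the convolution by \<open>Sum_any\<close> by a finite double sum over the
  supports, to which the ordinary \<open>sum\<close> rules apply.\<close>

lemma lookup_times:
  fixes p q :: "'a :: monoid_add \<Rightarrow>\<^sub>0 'b :: semiring_0"
  shows "Poly_Mapping.lookup (p * q) k =
    (\<Sum>a\<in>Poly_Mapping.keys p. \<Sum>b\<in>Poly_Mapping.keys q.
       if k = a + b then Poly_Mapping.lookup p a * Poly_Mapping.lookup q b else 0)"
proof -
  have inner: "(\<Sum>b. Poly_Mapping.lookup q b when k = a + b) =
      (\<Sum>b\<in>Poly_Mapping.keys q. Poly_Mapping.lookup q b when k = a + b)" for a
    by (rule Sum_any.expand_superset) (auto simp: in_keys_iff)
  have "Poly_Mapping.lookup (p * q) k =
      (\<Sum>a. Poly_Mapping.lookup p a * (\<Sum>b\<in>Poly_Mapping.keys q. Poly_Mapping.lookup q b when k = a + b))"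
    by (simp add: lookup_mult inner)
  also have "\<dots> = (\<Sum>a\<in>Poly_Mapping.keys p. Poly_Mapping.lookup p a *
      (\<Sum>b\<in>Poly_Mapping.keys q. Poly_Mapping.lookup q b when k = a + b))"
    by (rule Sum_any.expand_superset) (auto simp: in_keys_iff)
  also have "\<dots> = (\<Sum>a\<in>Poly_Mapping.keys p. \<Sum>b\<in>Poly_Mapping.keys q.
      if k = a + b then Poly_Mapping.lookup p a * Poly_Mapping.lookup q b else 0)"
    by (auto simp: sum_distrib_left when_def intro!: sum.cong)
  finally show ?thesis .
qed

lemma add_eq_double_imp_eq:
  fixes a b e :: "'a :: linordered_cancel_ab_semigroup_add"
  assumes "a \<le> e" "b \<le> e" "a + b = e + e"
  shows "a = e \<and> b = e"
  using assms by (metis add_less_le_mono add_le_less_mono order.not_eq_order_implies_strict less_irrefl)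

text \<open>Since \<open>e\<close> dominates the support in the graded order,
  \<open>e + e = a + b\<close> forces \<open>a = b = e\<close>, so one term of the convolution
  survives. The exponent \<open>e\<close> may lie outside the support, and then both sides are 0;
  this case occurs because \<open>e\<close> is later chosen for a whole family of
  polynomials.\<close>

lemma lookup_square_top:
  fixes p :: rpoly
  assumes "\<And>a. a \<in> Poly_Mapping.keys p \<Longrightarrow> exp_degree a \<le> exp_degree e"
    and "\<And>a. a \<in> Poly_Mapping.keys p \<Longrightarrow> exp_degree a = exp_degree e \<Longrightarrow> a \<le> e"
  shows "Poly_Mapping.lookup (p * p) (e + e) = (Poly_Mapping.lookup p e)\<^sup>2"
proof -
  let ?K = "Poly_Mapping.keys p"
  have top: "a = e \<and> b = e" if "a \<in> ?K" "b \<in> ?K" "e + e = a + b" for a b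
  proof -
    have "exp_degree a + exp_degree b = exp_degree e + exp_degree e"
      using that(3) by (metis exp_degree_add)
    with assms(1)[OF that(1)] assms(1)[OF that(2)]
    have "exp_degree a = exp_degree e" "exp_degree b = exp_degree e" by linarith+
    with assms(2) that show ?thesis by (metis add_eq_double_imp_eq)
  qed
  have "Poly_Mapping.lookup (p * p) (e + e) =
      (\<Sum>a\<in>?K. \<Sum>b\<in>?K. if b = e then if a = e then (Poly_Mapping.lookup p e)\<^sup>2 else 0 else 0)"
    unfolding lookup_times by (intro sum.cong refl) (auto simp: power2_eq_square dest: top)
  also have "\<dots> = (Poly_Mapping.lookup p e)\<^sup>2"
    by (cases "e \<in> ?K") (simp_all add: in_keys_iff)
  finally show ?thesis .
qed

lemma lookup_sum_poly_mapping: "Poly_Mapping.lookup (sum f I) k = (\<Sum>i\<in>I. Poly_Mapping.lookup (f i) k)"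
  by (induction I rule: infinite_finite_induct) (auto simp: lookup_add)

text \<open>Leading squares cannot cancel: take the largest exponent of the largest total degree.\<close>

lemma sum_squares_degree:
  fixes q :: "'i \<Rightarrow> rpoly"
  assumes fin: "finite I" and poly: "\<And>i. i \<in> I \<Longrightarrow> q i \<in> polys n"
    and le: "(\<Sum>i\<in>I. q i * q i) \<in> polys_le n (2 * d)" and i: "i \<in> I"
  shows "q i \<in> polys_le n d"
proof (rule ccontr)
  let ?K = "\<Union>i\<in>I. Poly_Mapping.keys (q i)"
  assume "q i \<notin> polys_le n d"
  with poly[OF i] obtain e0 where e0: "e0 \<in> Poly_Mapping.keys (q i)" "exp_degree e0 > d"
    by (force simp: polys_le_def)
  have finK: "finite ?K" using fin by simp
  have "e0 \<in> ?K" using e0 i by blast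
  \<comment> \<open>The maximum is over the supports of all \<open>q j\<close>, not just of
    \<open>q i\<close>, so that the same \<open>e\<close> is admissible in
    \<open>lookup_square_top\<close> for every \<open>j\<close>.\<close>
  define D where "D = Max (exp_degree ` ?K)"
  have D: "exp_degree a \<le> D" if "a \<in> ?K" for a
    unfolding D_def using finK that by simp
  define T where "T = {a \<in> ?K. exp_degree a = D}"
  have "D \<in> exp_degree ` ?K"
    unfolding D_def by (rule Max_in) (use finK \<open>e0 \<in> ?K\<close> in \<open>blast+\<close>)
  then have T: "finite T" "T \<noteq> {}"
    unfolding T_def by (blast intro: finite_subset[OF _ finK])+
  define e where "e = Max T"
  have e: "e \<in> ?K" "exp_degree e = D" using Max_in[OF T] by (auto simp: e_def T_def)
  have eD: "exp_degree e > d" using D[OF \<open>e0 \<in> ?K\<close>] e0 e by simp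
  have "Poly_Mapping.lookup (q j * q j) (e + e) = (Poly_Mapping.lookup (q j) e)\<^sup>2" if "j \<in> I" for j
    by (rule lookup_square_top)
      (use D e that T in \<open>auto simp: e_def T_def intro!: Max_ge\<close>)
  then have "Poly_Mapping.lookup (\<Sum>j\<in>I. q j * q j) (e + e) = (\<Sum>j\<in>I. (Poly_Mapping.lookup (q j) e)\<^sup>2)"
    by (simp add: lookup_sum_poly_mapping)
  also have "\<dots> > 0"
  proof -
    obtain j where "j \<in> I" "e \<in> Poly_Mapping.keys (q j)" using e by blast
    then show ?thesis by (intro sum_pos2[OF fin, of j]) (auto simp: in_keys_iff)
  qed
  finally have "e + e \<in> Poly_Mapping.keys (\<Sum>j\<in>I. q j * q j)" by (simp add: in_keys_iff)
  with le have "exp_degree (e + e) \<le> 2 * d" by (auto simp: polys_le_def)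
  with eD show False by (simp add: exp_degree_add)
qed

section \<open>Exponent lists and the expansion in monomials\<close>

text \<open>\<open>Poly_Mapping.nth\<close> pads with zeros and so identifies lists that differ only
  in trailing zeros; equal length excludes this.\<close>

lemma nth_exponent_inject:
  assumes "length es = length fs" "Poly_Mapping.nth es = (Poly_Mapping.nth fs :: nat \<Rightarrow>\<^sub>0 nat)"
  shows "es = fs"
proof (rule nth_equalityI)
  fix i assume "i < length es"
  moreover have "nth_default 0 es i = nth_default 0 fs i" using assms(2) by (metis lookup_nth)
  ultimately show "es ! i = fs ! i" using assms(1) by (simp add: nth_default_def)
qed (fact assms(1))

lemma inj_on_exponent: "inj_on Poly_Mapping.nth (set (exponents_le n d))"
  by (rule inj_onI) (auto simp: set_exponents_le intro: nth_exponent_inject)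

lemma image_exponents_le:
  "Poly_Mapping.nth ` set (exponents_le n d) =
     {e :: nat \<Rightarrow>\<^sub>0 nat. Poly_Mapping.keys e \<subseteq> {..<n} \<and> exp_degree e \<le> d}"
proof -
  have deg: "Poly_Mapping.keys (Poly_Mapping.nth es :: nat \<Rightarrow>\<^sub>0 nat) \<subseteq> {..<length es}"
    "exp_degree (Poly_Mapping.nth es) = sum_list es" for es :: "nat list"
  proof -
    show *: "Poly_Mapping.keys (Poly_Mapping.nth es :: nat \<Rightarrow>\<^sub>0 nat) \<subseteq> {..<length es}"
      by (auto simp: in_keys_iff nth_default_def simp del: keys_nth split: if_splits)
    show "exp_degree (Poly_Mapping.nth es) = sum_list es"
      by (simp add: exp_degree_superset[OF _ *] nth_default_def sum_list_sum_nth atLeast0LessThan)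
  qed
  have "e \<in> Poly_Mapping.nth ` set (exponents_le n d)"
    if e: "Poly_Mapping.keys e \<subseteq> {..<n}" "exp_degree e \<le> d" for e :: "nat \<Rightarrow>\<^sub>0 nat"
  proof
    \<comment> \<open>The inverse of padding: the first \<open>n\<close> values determine
      \<open>e\<close>, because its keys lie below \<open>n\<close>.\<close>
    let ?es = "map (Poly_Mapping.lookup e) [0..<n]"
    show eq: "e = Poly_Mapping.nth ?es"
      by (rule poly_mapping_eqI) (use e in \<open>auto simp: nth_default_def in_keys_iff\<close>)
    show "?es \<in> set (exponents_le n d)"
      using e(2) deg(2)[of ?es] unfolding eq[symmetric] set_exponents_le by simp
  qed
  then show ?thesis using deg by (force simp: set_exponents_le)
qed

text \<open>The sum runs over the whole column of monomials and not over the support of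
  \<open>p\<close>, so that the coefficients occupy fixed positions. It is reindexed twice: from
  exponents to lists, and from lists to positions.\<close>

lemma poly_eq_sum_monomials:
  assumes "p \<in> polys_le n d"
  shows "p = (\<Sum>a<length (exponents_le n d).
      const_poly (Poly_Mapping.lookup p (Poly_Mapping.nth (exponents_le n d ! a))) *
      monomial (exponents_le n d ! a))"
proof -
  let ?L = "exponents_le n d"
  let ?f = "\<lambda>e. Poly_Mapping.single e (Poly_Mapping.lookup p e)"
  have "p = (\<Sum>e\<in>Poly_Mapping.nth ` set ?L. ?f e)"
  proof (rule poly_mapping_eqI)
    fix k
    show "Poly_Mapping.lookup p k = Poly_Mapping.lookup (\<Sum>e\<in>Poly_Mapping.nth ` set ?L. ?f e) k"
    proof (cases "k \<in> Poly_Mapping.nth ` set ?L")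
      case True
      then show ?thesis by (simp add: lookup_sum_poly_mapping lookup_single when_def)
    next
      case False
      then have "k \<notin> Poly_Mapping.keys p"
        using assms unfolding image_exponents_le by (auto simp: polys_le_def polys_def)
      with False show ?thesis
        by (simp add: lookup_sum_poly_mapping lookup_single when_def in_keys_iff)
    qed
  qed
  also have "\<dots> = (\<Sum>es\<in>set ?L. ?f (Poly_Mapping.nth es))"
    by (rule sum.reindex[OF inj_on_exponent, unfolded o_def])
  also have "\<dots> = (\<Sum>a<length ?L. ?f (Poly_Mapping.nth (?L ! a)))"
    by (rule sum.reindex_bij_betw[symmetric], rule bij_betw_nth[OF distinct_exponents_le]) auto
  finally show ?thesis by (simp add: monomial_def mult_single)
qed

section \<open>Closure properties of \<open>polys\<close>\<close>

lemma monomial_in_polys: "es \<in> set (exponents_le n d) \<Longrightarrow> monomial es \<in> polys n"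
  using image_exponents_le[of n d] by (auto simp: monomial_def polys_def simp del: keys_nth)

lemma polys_0: "0 \<in> polys n"
  by (simp add: polys_def)

lemma polys_add: "p \<in> polys n \<Longrightarrow> q \<in> polys n \<Longrightarrow> p + q \<in> polys n"
  using Poly_Mapping.keys_add[of p q] by (auto simp: polys_def)

lemma polys_mult: "p \<in> polys n \<Longrightarrow> q \<in> polys n \<Longrightarrow> p * q \<in> polys n"
proof -
  assume pq: "p \<in> polys n" "q \<in> polys n"
  have "Poly_Mapping.keys e \<subseteq> {..<n}" if e: "e \<in> Poly_Mapping.keys (p * q)" for e
  proof -
    obtain a b where "e = a + b" "a \<in> Poly_Mapping.keys p" "b \<in> Poly_Mapping.keys q"
      using e Poly_Mapping.keys_mult[of p q] by blast
    with pq Poly_Mapping.keys_add[of a b] show ?thesis unfolding polys_def by blast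
  qed
  then show ?thesis by (simp add: polys_def)
qed

lemma polys_const: "const_poly c \<in> polys n"
  by (simp add: polys_def)

lemma polys_sum: "(\<And>i. i \<in> I \<Longrightarrow> f i \<in> polys n) \<Longrightarrow> sum f I \<in> polys n"
  by (induction I rule: infinite_finite_induct) (auto simp: polys_0 polys_add)

section \<open>Gram factorization of PSD matrices\<close>

text \<open>A Cholesky argument that eliminates the last index. With a zero pivot
  \<open>A k k\<close> the whole last row and column vanish; otherwise the Schur complement is again
  PSD and the induction hypothesis applies to it. With functions in place of matrices, passing to
  the leading block only shrinks the range of the indices.\<close>

lemma psd_gram_fun:
  fixes A :: "nat \<Rightarrow> nat \<Rightarrow> real"
  assumes "\<And>i j. i < k \<Longrightarrow> j < k \<Longrightarrow> A i j = A j i"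
    and "\<And>v. 0 \<le> (\<Sum>i<k. \<Sum>j<k. v i * A i j * v j)"
  shows "\<exists>L. \<forall>i<k. \<forall>j<k. A i j = (\<Sum>t<k. L t i * L t j)"
  using assms
proof (induction k arbitrary: A)
  case 0
  show ?case by simp
next
  case (Suc k)
  have quad: "(\<Sum>i<Suc k. \<Sum>j<Suc k. v i * A i j * v j) =
      (\<Sum>i<k. \<Sum>j<k. v i * A i j * v j) + 2 * v k * (\<Sum>i<k. A i k * v i) + A k k * (v k)\<^sup>2" for v
  proof -
    have "(\<Sum>j<k. v k * A k j * v j) = v k * (\<Sum>i<k. A i k * v i)"
      using Suc.prems(1) by (auto simp: sum_distrib_left intro!: sum.cong)
    moreover have "(\<Sum>i<k. v i * A i k * v k) = v k * (\<Sum>i<k. A i k * v i)"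
      by (auto simp: sum_distrib_left intro!: sum.cong)
    ultimately show ?thesis
      by (simp add: sum.distrib power2_eq_square)
  qed
  have diag: "0 \<le> A k k"
    using Suc.prems(2)[of "\<lambda>i. if i = k then 1 else 0"] unfolding quad by simp
  show ?case
  proof (cases "A k k = 0")
    case True
    have zero: "A i k = 0" if "i < k" for i
    proof (rule ccontr)
      assume nz: "A i k \<noteq> 0"
      \<comment> \<open>Chosen so that the form at the vector with entry 1 at \<open>i\<close> and
        \<open>c\<close> at \<open>k\<close> equals
        \<open>A i i + 2 * c * A i k = -1\<close>.\<close>
      define c where "c = - (A i i + 1) / (2 * A i k)"
      define v where "v j = (if j = k then c else if j = i then 1 else 0)" for j
      have "(\<Sum>a<k. \<Sum>b<k. v a * A a b * v b) = (\<Sum>a<k. \<Sum>b<k. if b = i then if a = i then A i i else 0 else 0)"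
        by (intro sum.cong) (auto simp: v_def)
      moreover have "(\<Sum>a<k. A a k * v a) = (\<Sum>a<k. if a = i then A i k else 0)"
        by (intro sum.cong) (auto simp: v_def)
      ultimately have "0 \<le> A i i + 2 * c * A i k"
        using Suc.prems(2)[of v] that True unfolding quad by (simp add: v_def)
      with nz show False by (simp add: c_def field_simps)
    qed
    have "0 \<le> (\<Sum>i<k. \<Sum>j<k. v i * A i j * v j)" for v
      using Suc.prems(2)[of "v(k := 0)"] unfolding quad by simp
    with Suc.IH[of A] Suc.prems(1) obtain L
      where L: "\<And>i j. i < k \<Longrightarrow> j < k \<Longrightarrow> A i j = (\<Sum>t<k. L t i * L t j)" by auto
    \<comment> \<open>The induction hypothesis says nothing about \<open>L\<close> at the index
      \<open>k\<close>; zeros there match the vanishing row and column.\<close>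
    have "A i j = (\<Sum>t<Suc k. (if t < k \<and> i < k then L t i else 0) * (if t < k \<and> j < k then L t j else 0))"
      if "i < Suc k" "j < Suc k" for i j
      using that L zero True Suc.prems(1)[of i j] by (auto simp: less_Suc_eq)
    then show ?thesis
      by (intro exI[of _ "\<lambda>t i. if t < k \<and> i < k then L t i else 0"]) blast
  next
    case False
    with diag have pos: "A k k > 0" by simp
    \<comment> \<open>The Schur complement of the pivot \<open>A k k\<close>.\<close>
    define B where "B i j = A i j - A i k * A j k / A k k" for i j
    have "0 \<le> (\<Sum>i<k. \<Sum>j<k. v i * B i j * v j)" for v
    proof -
      define S where "S = (\<Sum>i<k. A i k * v i)"
      have "(\<Sum>i<k. \<Sum>j<k. v i * B i j * v j) = (\<Sum>i<k. \<Sum>j<k. v i * A i j * v j) - S * S / A k k"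
        by (simp add: B_def S_def sum_product sum_divide_distrib algebra_simps flip: sum_subtractf)
      \<comment> \<open>The value \<open>- S / A k k\<close> of the last coordinate minimizes the
        form of \<open>A\<close>, and the minimum is the form of the Schur complement.\<close>
      also have "\<dots> = (\<Sum>i<Suc k. \<Sum>j<Suc k. (v(k := - S / A k k)) i * A i j * (v(k := - S / A k k)) j)"
        unfolding quad using False by (simp add: power2_eq_square S_def)
      finally show ?thesis using Suc.prems(2)[of "v(k := - S / A k k)"] by simp
    qed
    moreover have "B i j = B j i" if "i < k" "j < k" for i j
      using that Suc.prems(1)[of i j] by (simp add: B_def)
    ultimately obtain L where L: "\<And>i j. i < k \<Longrightarrow> j < k \<Longrightarrow> B i j = (\<Sum>t<k. L t i * L t j)"
      using Suc.IH[of B] by auto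
    \<comment> \<open>The new last row restores the rank-one term subtracted in \<open>B\<close>;
      the old rows are 0 in column \<open>k\<close>.\<close>
    define M where "M t i = (if t < k then if i < k then L t i else 0 else A i k / sqrt (A k k))" for t i
    have "A i j = (\<Sum>t<Suc k. M t i * M t j)" if "i < Suc k" "j < Suc k" for i j
    proof -
      have "(\<Sum>t<Suc k. M t i * M t j) =
          (\<Sum>t<k. (if i < k then L t i else 0) * (if j < k then L t j else 0)) + A i k * A j k / A k k"
        using pos by (simp add: M_def)
      also have "\<dots> = A i j"
      proof (cases "i < k \<and> j < k")
        case True
        then show ?thesis using L[of i j] by (simp add: B_def)
      next
        case False
        then have "i = k \<or> j = k" using that by auto
        then show ?thesis using pos Suc.prems(1)[of i j] that by auto
      qed
      finally show ?thesis ..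
    qed
    then show ?thesis by blast
  qed
qed

lemma gram_mat_index:
  "L \<in> carrier_mat s k \<Longrightarrow> i < k \<Longrightarrow> j < k \<Longrightarrow>
    (L\<^sup>T * L) $$ (i, j) = (\<Sum>t<s. L $$ (t, i) * L $$ (t, j))"
  by (simp add: scalar_prod_def atLeast0LessThan)

lemma psd_mats_gram:
  assumes "X \<in> psd_mats k"
  obtains L where "L \<in> carrier_mat k k" "X = L\<^sup>T * L"
proof -
  have X: "X \<in> carrier_mat k k" "X\<^sup>T = X" "\<And>v. v \<in> carrier_vec k \<Longrightarrow> 0 \<le> v \<bullet> (X *\<^sub>v v)"
    using assms by (auto simp: psd_mats_def)
  have "X $$ (i, j) = X $$ (j, i)" if "i < k" "j < k" for i j
    using X that by (metis carrier_matD index_transpose_mat(1))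
  moreover have "0 \<le> (\<Sum>i<k. \<Sum>j<k. v i * X $$ (i, j) * v j)" for v
    using X(3)[of "vec k v"] X(1)
    by (simp add: scalar_prod_def atLeast0LessThan sum_distrib_left mult.assoc)
  ultimately obtain L where L: "\<And>i j. i < k \<Longrightarrow> j < k \<Longrightarrow> X $$ (i, j) = (\<Sum>t<k. L t i * L t j)"
    using psd_gram_fun[of k "\<lambda>i j. X $$ (i, j)"] by blast
  let ?L = "mat k k (\<lambda>(t, i). L t i)"
  have "X = ?L\<^sup>T * ?L"
    by (rule eq_matI) (use X L in \<open>auto simp: scalar_prod_def atLeast0LessThan\<close>)
  then show thesis by (rule that[rotated]) simp
qed

lemma gram_in_psd_mats:
  fixes L :: "real mat"
  assumes L: "L \<in> carrier_mat s k"
  shows "L\<^sup>T * L \<in> psd_mats k"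
proof -
  have "0 \<le> v \<bullet> (L\<^sup>T * L *\<^sub>v v)" if v: "v \<in> carrier_vec k" for v
  proof -
    have "v \<bullet> (L\<^sup>T * L *\<^sub>v v) = v \<bullet> (L\<^sup>T *\<^sub>v (L *\<^sub>v v))"
      using L v by (simp add: assoc_mult_mat_vec[of _ k s])
    also have "\<dots> = (L *\<^sub>v v) \<bullet> (L *\<^sub>v v)"
      using L v transpose_vec_mult_scalar[of L s k v "L *\<^sub>v v"]
      by (metis carrier_vecI comm_scalar_prod dim_mult_mat_vec mult_mat_vec_carrier transpose_carrier_mat)
    also have "\<dots> \<ge> 0" by (simp add: scalar_prod_def sum_nonneg)
    finally show ?thesis .
  qed
  then show ?thesis
    using L by (auto simp: psd_mats_def transpose_mult[of _ k s])
qed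

section \<open>Sums of matrices and congruences\<close>

text \<open>Allows \<open>map_mat const_poly\<close> to be pushed through matrix products and,
  below, through \<open>mat_sum\<close>.\<close>

interpretation const_poly: semiring_hom "const_poly :: real \<Rightarrow> rpoly"
  by unfold_locales (simp_all add: single_add mult_single)

lemma mat_sum_carrier [simp]: "mat_sum nr nc f I \<in> carrier_mat nr nc"
  by (simp add: mat_sum_def)

lemma mat_sum_index [simp]:
  "a < nr \<Longrightarrow> b < nc \<Longrightarrow> mat_sum nr nc f I $$ (a, b) = (\<Sum>i\<in>I. f i $$ (a, b))"
  by (simp add: mat_sum_def)

lemma mat_sum_cong:
  "(\<And>i. i \<in> I \<Longrightarrow> f i = g i) \<Longrightarrow> mat_sum nr nc f I = mat_sum nr nc g I"
  by (simp add: mat_sum_def cong: sum.cong)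

lemma mat_sum_mult_distrib:
  fixes A :: "'a :: semiring_0 mat"
  assumes A: "A \<in> carrier_mat m p" and B: "B \<in> carrier_mat q k"
    and f: "\<And>i. i \<in> I \<Longrightarrow> f i \<in> carrier_mat p q"
  shows "A * mat_sum p q f I * B = mat_sum m k (\<lambda>i. A * f i * B) I"
proof (rule eq_matI)
  fix a b assume "a < dim_row (mat_sum m k (\<lambda>i. A * f i * B) I)"
    and "b < dim_col (mat_sum m k (\<lambda>i. A * f i * B) I)"
  then have ab: "a < m" "b < k" by (simp_all add: mat_sum_def)
  have triple: "(A * X * B) $$ (a, b) = (\<Sum>j<q. \<Sum>i<p. A $$ (a, i) * X $$ (i, j) * B $$ (j, b))"
    if "X \<in> carrier_mat p q" for X
    using that A B ab
    by (simp add: scalar_prod_def atLeast0LessThan sum_distrib_right del: assoc_mult_mat)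
  have "(A * mat_sum p q f I * B) $$ (a, b) =
      (\<Sum>j<q. \<Sum>i<p. \<Sum>t\<in>I. A $$ (a, i) * f t $$ (i, j) * B $$ (j, b))"
    by (simp add: triple sum_distrib_left sum_distrib_right)
  also have "\<dots> = (\<Sum>j<q. \<Sum>t\<in>I. \<Sum>i<p. A $$ (a, i) * f t $$ (i, j) * B $$ (j, b))"
    by (rule sum.cong[OF refl], rule sum.swap)
  also have "\<dots> = (\<Sum>t\<in>I. \<Sum>j<q. \<Sum>i<p. A $$ (a, i) * f t $$ (i, j) * B $$ (j, b))"
    by (rule sum.swap)
  also have "\<dots> = mat_sum m k (\<lambda>i. A * f i * B) I $$ (a, b)"
    using ab f by (simp add: triple)
  finally show "(A * mat_sum p q f I * B) $$ (a, b) = mat_sum m k (\<lambda>i. A * f i * B) I $$ (a, b)" .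
qed (use A B in \<open>auto simp: mat_sum_def\<close>)

lemma (in semiring_hom) map_mat_mat_sum:
  assumes "\<And>i. i \<in> I \<Longrightarrow> f i \<in> carrier_mat m k"
  shows "map_mat hom (mat_sum m k f I) = mat_sum m k (\<lambda>i. map_mat hom (f i)) I"
proof (rule eq_matI)
  fix a b assume "a < dim_row (mat_sum m k (\<lambda>i. map_mat hom (f i)) I)"
    and "b < dim_col (mat_sum m k (\<lambda>i. map_mat hom (f i)) I)"
  then have ab: "a < m" "b < k" by (simp_all add: mat_sum_def)
  have "hom (\<Sum>i\<in>I. f i $$ (a, b)) = (\<Sum>i\<in>I. map_mat hom (f i) $$ (a, b))"
    using assms
  proof (induction I rule: infinite_finite_induct)
    case (insert x F)
    have "dim_row (f x) = m" "dim_col (f x) = k" using insert.prems by auto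
    with insert ab show ?case by (simp add: hom_add)
  qed (simp_all add: hom_zero)
  then show "map_mat hom (mat_sum m k f I) $$ (a, b) =
      mat_sum m k (\<lambda>i. map_mat hom (f i)) I $$ (a, b)"
    using ab by (simp add: mat_sum_def)
qed (simp_all add: mat_sum_def)

lemma finite_index_pairs [simp]: "finite (index_pairs p)"
  by (rule finite_subset[of _ "{..<p} \<times> {..<p}"]) (auto simp: index_pairs_def)

lemma congruence_gram:
  fixes E L :: "'a :: comm_semiring_1 mat"
  assumes "E \<in> carrier_mat p q" "L \<in> carrier_mat s p"
  shows "E\<^sup>T * (L\<^sup>T * L) * E = (L * E)\<^sup>T * (L * E)"
proof -
  have "E\<^sup>T * (L\<^sup>T * L) * E = E\<^sup>T * (L\<^sup>T * (L * E))"
    using assms by (simp add: assoc_mult_mat[of _ q p _ p _ q] assoc_mult_mat[of _ p s _ p _ q])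
  also have "\<dots> = (L * E)\<^sup>T * (L * E)"
    using assms by (simp add: transpose_mult[of L s p E q] assoc_mult_mat[of _ q p _ s _ q])
  finally show ?thesis .
qed

text \<open>Merges two nested congruences into one by the product. It serves twice: for a block
  selection followed by the monomials of all \<open>r\<close> blocks, and for the monomials of two
  blocks followed by \<open>E_pair\<close>.\<close>

lemma congruence_congruence:
  fixes V E X :: "'a :: comm_semiring_1 mat"
  assumes "V \<in> carrier_mat m r" "E \<in> carrier_mat p m" "X \<in> carrier_mat p p"
  shows "V\<^sup>T * (E\<^sup>T * X * E) * V = (E * V)\<^sup>T * X * (E * V)"
proof -
  define Y where "Y = X * (E * V)"
  have Y: "Y \<in> carrier_mat p r" unfolding Y_def using assms by (intro mult_carrier_mat)
  have "E\<^sup>T * X * E * V = E\<^sup>T * X * (E * V)"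
    using assms by (intro assoc_mult_mat[of _ m p _ m _ r]) auto
  also have "\<dots> = E\<^sup>T * Y"
    unfolding Y_def using assms by (intro assoc_mult_mat[of _ m p _ p _ r]) auto
  finally have "V\<^sup>T * (E\<^sup>T * X * E) * V = V\<^sup>T * (E\<^sup>T * Y)"
    using assms by (subst assoc_mult_mat[of _ r m _ m _ r]) auto
  also have "\<dots> = V\<^sup>T * E\<^sup>T * Y"
    using assms Y by (intro assoc_mult_mat[symmetric, of _ r m _ p _ r]) auto
  also have "\<dots> = (E * V)\<^sup>T * (X * (E * V))"
    using assms by (simp add: transpose_mult[of E p m V r] Y_def del: assoc_mult_mat)
  also have "\<dots> = (E * V)\<^sup>T * X * (E * V)"
    using assms by (intro assoc_mult_mat[symmetric, of _ r p _ p _ r]) auto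
  finally show ?thesis .
qed

section \<open>Selection matrices\<close>

lemma append_rows_index:
  assumes "A \<in> carrier_mat p k" "B \<in> carrier_mat q k" "a < p + q" "b < k"
  shows "(A @\<^sub>r B) $$ (a, b) = (if a < p then A $$ (a, b) else B $$ (a - p, b))"
  using assms by (simp add: append_rows_def)

lemma E_pair_carrier: "E_pair r i j \<in> carrier_mat 2 r"
  unfolding E_pair_def E_row_def
  using carrier_append_rows[of "mat_of_row (row (1\<^sub>m r) i)" 1 r "mat_of_row (row (1\<^sub>m r) j)" 1]
  by (simp add: numeral_2_eq_2 mat_of_row_def)

lemma E_pair_index:
  assumes "i < r" "j < r" "a < 2" "b < r"
  shows "E_pair r i j $$ (a, b) = (if b = (if a = 0 then i else j) then 1 else 0)"
proof -
  have "E_row r k \<in> carrier_mat 1 r" for k by (simp add: E_row_def mat_of_row_def)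
  then show ?thesis
    unfolding E_pair_def using assms
    by (subst append_rows_index[of _ 1 r _ 1]) (auto simp: E_row_def mat_of_row_def)
qed

lemma E_block_carrier: "E_block m \<alpha> i \<in> carrier_mat (\<alpha> ! i) m"
  by (simp add: E_block_def)

lemma E_block_pair_carrier: "E_block_pair m \<alpha> i j \<in> carrier_mat (\<alpha> ! i + \<alpha> ! j) m"
  unfolding E_block_pair_def by (intro carrier_append_rows E_block_carrier)

lemma E_block_pair_replicate_carrier:
  "i < r \<Longrightarrow> j < r \<Longrightarrow> E_block_pair m (replicate r N) i j \<in> carrier_mat (2 * N) m"
  using E_block_pair_carrier[of m "replicate r N" i j] by (simp add: mult_2)

text \<open>Block \<open>k\<close> of the homogeneous partition starts at \<open>k * N\<close>. As
  \<open>a < 2 * N\<close>, the offset inside the block is \<open>a mod N\<close> in both halves of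
  the stacked matrix.\<close>

lemma E_block_pair_replicate_index:
  assumes "i < r" "j < r" "a < 2 * N" "b < r * N"
  shows "(E_block_pair (r * N) (replicate r N) i j :: 'a :: {zero, one} mat) $$ (a, b) =
    (if b = (if a < N then i else j) * N + a mod N then 1 else 0)"
proof -
  have idx: "k * N + c < r * N" if "k < r" "c < N" for k c
  proof -
    have "k * N + c < Suc k * N" using that by simp
    also have "\<dots> \<le> r * N" using that by (intro mult_le_mono1) simp
    finally show ?thesis .
  qed
  have blk: "(E_block (r * N) (replicate r N) k :: 'a mat) $$ (c, b) = (if b = k * N + c then 1 else 0)"
    if "k < r" "c < N" for k c
    using that assms(4) idx[OF that] by (auto simp: E_block_def sum_list_replicate min_def)
  have "(E_block_pair (r * N) (replicate r N) i j :: 'a mat) $$ (a, b) =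
      (if a < N then E_block (r * N) (replicate r N) i $$ (a, b)
       else E_block (r * N) (replicate r N) j $$ (a - N, b))"
    unfolding E_block_pair_def
    by (subst append_rows_index[OF E_block_carrier E_block_carrier]) (use assms in auto)
  also have "\<dots> = (if b = (if a < N then i else j) * N + a mod N then 1 else 0)"
    using assms blk[of i a] blk[of j "a - N"] by (auto simp: mod_if)
  finally show ?thesis .
qed

lemma row_selection_mult:
  fixes S V :: "'a :: semiring_1 mat"
  assumes "S \<in> carrier_mat p m" "V \<in> carrier_mat m k" "a < p" "b < k" "c < m"
    and "\<And>t. t < m \<Longrightarrow> S $$ (a, t) = (if t = c then 1 else 0)"
  shows "(S * V) $$ (a, b) = V $$ (c, b)"
proof -
  have "(S * V) $$ (a, b) = (\<Sum>t<m. (if t = c then 1 else 0) * V $$ (t, b))"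
    using assms by (simp add: scalar_prod_def atLeast0LessThan)
  also have "\<dots> = (\<Sum>t<m. if t = c then V $$ (t, b) else 0)"
    by (rule sum.cong) auto
  finally show ?thesis using assms(5) by simp
qed

text \<open>The entries are 0 and 1, which \<open>const_poly\<close> preserves.\<close>

lemma map_const_E_block_pair:
  assumes "sum_list \<alpha> = m" "i < length \<alpha>" "j < length \<alpha>"
  shows "map_mat const_poly (E_block_pair m \<alpha> i j) = E_block_pair m \<alpha> i j"
proof -
  have blk: "map_mat const_poly (E_block m \<alpha> k) = E_block m \<alpha> k" if "k < length \<alpha>" for k
  proof -
    \<comment> \<open>This keeps block \<open>k\<close> within the rows of
      \<open>1\<^sub>m m\<close>; entries beyond them would be unspecified.\<close>
    have "sum_list (take k \<alpha>) + \<alpha> ! k + sum_list (drop (Suc k) \<alpha>) = m"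
      unfolding assms(1)[symmetric]
      by (metis append_take_drop_id sum_list_append take_Suc_conv_app_nth[OF that] sum_list.Cons
          sum_list.Nil add_0_right)
    then show ?thesis by (intro eq_matI) (auto simp: E_block_def)
  qed
  have "map_mat const_poly (A @\<^sub>r B) = map_mat const_poly A @\<^sub>r map_mat const_poly B"
    if "A \<in> carrier_mat p m" "B \<in> carrier_mat q m" for A B p q
    using that by (intro eq_matI) (auto simp: append_rows_def)
  from this[OF E_block_carrier E_block_carrier] show ?thesis
    by (simp add: E_block_pair_def blk assms)
qed

section \<open>The Kronecker product with the column of monomials\<close>

text \<open>The number \<open>p\<close> of blocks is a parameter because both \<open>r\<close> and 2
  occur.\<close>

definition I_monomials :: "nat \<Rightarrow> nat \<Rightarrow> nat \<Rightarrow> rpoly mat" where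
  "I_monomials n d p = 1\<^sub>m p \<otimes>\<^sub>K monomial_col n d"

context
  fixes n d N :: nat
  assumes N: "N = (n + d) choose d"
begin

lemma I_monomials_carrier: "I_monomials n d p \<in> carrier_mat (p * N) p"
  by (simp add: I_monomials_def kronecker_def monomial_col_def length_exponents_le N)

lemma N_pos: "N > 0"
  by (simp add: N)

lemma I_monomials_index:
  assumes "a < p * N" "b < p"
  shows "I_monomials n d p $$ (a, b) =
    (if a div N = b then monomial (exponents_le n d ! (a mod N)) else 0)"
proof -
  have "a div N < p" using assms by (simp add: less_mult_imp_div_less)
  then show ?thesis
    using assms N_pos
    by (simp add: I_monomials_def kronecker_def monomial_col_def length_exponents_le N[symmetric])
qed

text \<open>In row \<open>a\<close> both sides carry the monomial at position
  \<open>a mod N\<close>, in column \<open>i\<close> for \<open>a < N\<close> and in column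
  \<open>j\<close> otherwise, and zeros elsewhere.\<close>

lemma E_block_pair_mult_I_monomials:
  assumes "i < r" "j < r"
  shows "E_block_pair (r * N) (replicate r N) i j * I_monomials n d r = I_monomials n d 2 * E_pair r i j"
    (is "?S * _ = _")
proof (rule eq_matI)
  have S: "?S \<in> carrier_mat (2 * N) (r * N)"
    by (rule E_block_pair_replicate_carrier[OF assms])
  show "dim_row (?S * I_monomials n d r) = dim_row (I_monomials n d 2 * E_pair r i j)"
    "dim_col (?S * I_monomials n d r) = dim_col (I_monomials n d 2 * E_pair r i j)"
    using S I_monomials_carrier[of r] I_monomials_carrier[of 2] E_pair_carrier[of r i j, where 'a = rpoly]
    by auto
  fix a b assume "a < dim_row (I_monomials n d 2 * E_pair r i j)" "b < dim_col (I_monomials n d 2 * E_pair r i j)"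
  then have ab: "a < 2 * N" "b < r"
    using I_monomials_carrier[of 2] E_pair_carrier[of r i j, where 'a = rpoly] by auto
  let ?k = "if a < N then i else j"
  let ?v = "monomial (exponents_le n d ! (a mod N))"
  have k: "?k < r" using assms by simp
  have idx: "?k * N + a mod N < r * N"
  proof -
    have "?k * N + a mod N < Suc ?k * N" using N_pos by simp
    also have "\<dots> \<le> r * N" using k by (intro mult_le_mono1) simp
    finally show ?thesis .
  qed
  have "(?S * I_monomials n d r) $$ (a, b) = I_monomials n d r $$ (?k * N + a mod N, b)"
    by (rule row_selection_mult[OF S I_monomials_carrier])
      (use ab idx assms in \<open>simp_all add: E_block_pair_replicate_index\<close>)
  also have "\<dots> = (if ?k = b then ?v else 0)"
    using idx ab N_pos by (subst I_monomials_index) simp_all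
  also have "\<dots> = (\<Sum>c<2. I_monomials n d 2 $$ (a, c) * E_pair r i j $$ (c, b))"
  proof -
    have "a div N = (if a < N then 0 else 1)" using ab by (auto simp: div_if)
    then show ?thesis using ab assms
      by (simp add: numeral_2_eq_2 E_pair_index I_monomials_index)
  qed
  also have "\<dots> = (I_monomials n d 2 * E_pair r i j) $$ (a, b)"
    using ab I_monomials_carrier[of 2] E_pair_carrier[of r i j, where 'a = rpoly]
    by (simp add: scalar_prod_def atLeast0LessThan)
  finally show "(?S * I_monomials n d r) $$ (a, b) = (I_monomials n d 2 * E_pair r i j) $$ (a, b)" .
qed

text \<open>Both directions of the theorem rest on this identity, with the same matrices
  \<open>X i j\<close> on its two sides.\<close>

lemma I_monomials_congruence_FW2_sum:
  assumes X: "\<And>i j. (i, j) \<in> index_pairs r \<Longrightarrow> X i j \<in> carrier_mat (2 * N) (2 * N)"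
  shows "(I_monomials n d r)\<^sup>T * map_mat const_poly (mat_sum (r * N) (r * N)
       (\<lambda>(i, j). (E_block_pair (r * N) (replicate r N) i j)\<^sup>T * X i j *
          E_block_pair (r * N) (replicate r N) i j) (index_pairs r)) * I_monomials n d r =
     mat_sum r r (\<lambda>(i, j). (E_pair r i j)\<^sup>T *
       ((I_monomials n d 2)\<^sup>T * map_mat const_poly (X i j) * I_monomials n d 2) * E_pair r i j) (index_pairs r)"
    (is "?V\<^sup>T * map_mat _ (mat_sum ?m ?m ?f _) * ?V = mat_sum r r ?g _")
proof -
  let ?S = "E_block_pair ?m (replicate r N)"
  note V = I_monomials_carrier[of r] and W = I_monomials_carrier[of 2]
  have f: "?f ij \<in> carrier_mat ?m ?m" if "ij \<in> index_pairs r" for ij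
  proof (cases ij)
    case (Pair i j)
    then have "?S i j \<in> carrier_mat (2 * N) ?m"
      using that by (intro E_block_pair_replicate_carrier) (auto simp: index_pairs_def)
    with Pair that X[of i j] show ?thesis
      by (auto intro!: mult_carrier_mat[of _ _ "2 * N"])
  qed
  have "?V\<^sup>T * map_mat const_poly (mat_sum ?m ?m ?f (index_pairs r)) * ?V =
      mat_sum r r (\<lambda>ij. ?V\<^sup>T * map_mat const_poly (?f ij) * ?V) (index_pairs r)"
  proof -
    have "map_mat const_poly (mat_sum ?m ?m ?f (index_pairs r)) =
        mat_sum ?m ?m (\<lambda>ij. map_mat const_poly (?f ij)) (index_pairs r)"
      by (rule const_poly.map_mat_mat_sum) (rule f)
    moreover have "?V\<^sup>T * mat_sum ?m ?m (\<lambda>ij. map_mat const_poly (?f ij)) (index_pairs r) * ?V =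
        mat_sum r r (\<lambda>ij. ?V\<^sup>T * map_mat const_poly (?f ij) * ?V) (index_pairs r)"
      by (rule mat_sum_mult_distrib) (use V f in \<open>simp_all only: transpose_carrier_mat map_carrier_mat\<close>)
    ultimately show ?thesis by simp
  qed
  also have "\<dots> = mat_sum r r ?g (index_pairs r)"
  proof (rule mat_sum_cong)
    fix ij assume ij: "ij \<in> index_pairs r"
    obtain i j where [simp]: "ij = (i, j)" by (cases ij)
    have ij': "i < r" "j < r" using ij by (auto simp: index_pairs_def)
    note S' = E_block_pair_replicate_carrier[OF ij', of ?m N, where 'a = real]
      E_block_pair_replicate_carrier[OF ij', of ?m N, where 'a = rpoly] X[of i j]
    \<comment> \<open>Here the real selection matrices turn into the polynomial ones.\<close>
    have "map_mat const_poly (?f ij) = (?S i j)\<^sup>T * map_mat const_poly (X i j) * ?S i j"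
      using S' ij
      by (simp add: const_poly.mat_hom_mult[of _ ?m "2 * N" _ ?m]
          const_poly.mat_hom_mult[of _ ?m "2 * N" _ "2 * N"] map_mat_transpose[symmetric]
          map_const_E_block_pair sum_list_replicate ij' del: assoc_mult_mat)
    then have "?V\<^sup>T * map_mat const_poly (?f ij) * ?V =
        (?S i j * ?V)\<^sup>T * map_mat const_poly (X i j) * (?S i j * ?V)"
      using S' ij V by (simp add: congruence_congruence[of _ ?m r _ "2 * N"] del: assoc_mult_mat)
    also have "\<dots> = (I_monomials n d 2 * E_pair r i j)\<^sup>T * map_mat const_poly (X i j) *
        (I_monomials n d 2 * E_pair r i j)"
      by (simp add: E_block_pair_mult_I_monomials ij')
    also have "\<dots> = ?g ij"
      using S' ij W by (simp add: E_pair_carrier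
          congruence_congruence[of "E_pair r i j" 2 r "I_monomials n d 2" "2 * N"] del: assoc_mult_mat)
    finally show "?V\<^sup>T * map_mat const_poly (?f ij) * ?V = ?g ij" .
  qed
  finally show ?thesis .
qed

text \<open>Separates coefficients from monomials: each polynomial entry of \<open>M\<close> unfolds
  into a block of \<open>N\<close> real entries of \<open>C\<close>.\<close>

lemma eq_const_mult_I_monomials:
  assumes M: "M \<in> carrier_mat s p"
    and le: "\<And>t b. t < s \<Longrightarrow> b < p \<Longrightarrow> M $$ (t, b) \<in> polys_le n d"
  obtains C where "C \<in> carrier_mat s (p * N)" "M = map_mat const_poly C * I_monomials n d p"
proof
  let ?m = "\<lambda>c. exponents_le n d ! c"
  \<comment> \<open>Column \<open>a\<close> of \<open>C\<close> belongs to column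
    \<open>a div N\<close> of \<open>M\<close> and to the monomial at position
    \<open>a mod N\<close>.\<close>
  let ?C = "mat s (p * N) (\<lambda>(t, a).
    Poly_Mapping.lookup (M $$ (t, a div N)) (Poly_Mapping.nth (?m (a mod N))))"
  show "?C \<in> carrier_mat s (p * N)" by simp
  show "M = map_mat const_poly ?C * I_monomials n d p"
  proof (rule eq_matI)
    fix t b assume "t < dim_row (map_mat const_poly ?C * I_monomials n d p)"
      "b < dim_col (map_mat const_poly ?C * I_monomials n d p)"
    then have tb: "t < s" "b < p" using I_monomials_carrier[of p] by auto
    let ?f = "\<lambda>a. map_mat const_poly ?C $$ (t, a) * I_monomials n d p $$ (a, b)"
    \<comment> \<open>Column \<open>b\<close> of \<open>I_monomials n d p\<close> vanishes outside
      the rows \<open>b * N + c\<close> with \<open>c < N\<close>, so the sum shrinks to this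
      block.\<close>
    have block: "(\<lambda>c. b * N + c) ` {..<N} \<subseteq> {..<p * N}"
    proof -
      have "b * N + c < p * N" if "c < N" for c
      proof -
        have "b * N + c < Suc b * N" using that by simp
        also have "\<dots> \<le> p * N" using tb by (intro mult_le_mono1) simp
        finally show ?thesis .
      qed
      then show ?thesis by auto
    qed
    have outside: "?f a = 0" if "a \<in> {..<p * N} - (\<lambda>c. b * N + c) ` {..<N}" for a
    proof -
      have "a div N \<noteq> b"
      proof
        assume "a div N = b"
        then have "a = b * N + a mod N" by (metis div_mult_mod_eq)
        with that N_pos show False by (metis DiffD2 imageI lessThan_iff mod_less_divisor)
      qed
      with that tb show ?thesis by (simp add: I_monomials_index)
    qed
    have "(map_mat const_poly ?C * I_monomials n d p) $$ (t, b) = (\<Sum>a<p * N. ?f a)"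
      using tb I_monomials_carrier[of p] by (simp add: scalar_prod_def atLeast0LessThan)
    also have "\<dots> = (\<Sum>a\<in>(\<lambda>c. b * N + c) ` {..<N}. ?f a)"
      by (rule sum.mono_neutral_right) (use block outside in auto)
    also have "\<dots> = (\<Sum>c<N. ?f (b * N + c))"
      by (subst sum.reindex) (auto simp: inj_on_def)
    also have "\<dots> = (\<Sum>c<N. const_poly (Poly_Mapping.lookup (M $$ (t, b)) (Poly_Mapping.nth (?m c))) *
        monomial (?m c))"
    proof (rule sum.cong[OF refl])
      fix c assume "c \<in> {..<N}"
      with block have "b * N + c < p * N" "c < N" by auto
      then show "?f (b * N + c) =
          const_poly (Poly_Mapping.lookup (M $$ (t, b)) (Poly_Mapping.nth (?m c))) * monomial (?m c)"
        using tb by (simp add: I_monomials_index)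
    qed
    also have "\<dots> = M $$ (t, b)"
      using poly_eq_sum_monomials[OF le[OF tb]] by (simp add: length_exponents_le N)
    finally show "M $$ (t, b) = (map_mat const_poly ?C * I_monomials n d p) $$ (t, b)" ..
  qed (use M I_monomials_carrier[of p] in auto)
qed

end

section \<open>Membership in \<open>FW2\<close> and in the SOS matrices\<close>

lemma transpose_mat_sum:
  assumes "\<And>i. i \<in> I \<Longrightarrow> f i \<in> carrier_mat m k"
  shows "(mat_sum m k f I)\<^sup>T = mat_sum k m (\<lambda>i. (f i)\<^sup>T) I"
proof (rule eq_matI)
  fix a b assume "a < dim_row (mat_sum k m (\<lambda>i. (f i)\<^sup>T) I)" "b < dim_col (mat_sum k m (\<lambda>i. (f i)\<^sup>T) I)"
  then have ab: "a < k" "b < m" by (simp_all add: mat_sum_def)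
  have "f i $$ (b, a) = (f i)\<^sup>T $$ (a, b)" if "i \<in> I" for i
    using assms[OF that] ab by simp
  then show "(mat_sum m k f I)\<^sup>T $$ (a, b) = mat_sum k m (\<lambda>i. (f i)\<^sup>T) I $$ (a, b)"
    using ab by (simp add: mat_sum_def)
qed (simp_all add: mat_sum_def)

lemma transpose_congruence:
  fixes S X :: "'a :: comm_semiring_1 mat"
  assumes "S \<in> carrier_mat k m" "X \<in> carrier_mat k k" "X\<^sup>T = X"
  shows "(S\<^sup>T * X * S)\<^sup>T = S\<^sup>T * X * S"
proof -
  have "(S\<^sup>T * X * S)\<^sup>T = S\<^sup>T * (S\<^sup>T * X)\<^sup>T"
    using assms by (intro transpose_mult[of _ m k _ m]) auto
  also have "(S\<^sup>T * X)\<^sup>T = X * S"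
    using assms transpose_mult[of "S\<^sup>T" m k X k] by simp
  also have "S\<^sup>T * (X * S) = S\<^sup>T * X * S"
    using assms by (intro assoc_mult_mat[symmetric, of _ m k _ k _ m]) auto
  finally show ?thesis .
qed

text \<open>The symmetry that \<open>FW2\<close> demands of the sum is inherited from its summands,
  since each \<open>X i j\<close> is symmetric.\<close>

lemma mat_sum_congruence_in_FW2:
  assumes X: "\<And>i j. (i, j) \<in> index_pairs (length \<alpha>) \<Longrightarrow> X i j \<in> psd_mats (\<alpha> ! i + \<alpha> ! j)"
  shows "mat_sum m m (\<lambda>(i, j). (E_block_pair m \<alpha> i j)\<^sup>T * X i j * E_block_pair m \<alpha> i j)
    (index_pairs (length \<alpha>)) \<in> FW2 m \<alpha>"
    (is "mat_sum m m ?f ?I \<in> _")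
proof -
  have "?f ij \<in> carrier_mat m m \<and> (?f ij)\<^sup>T = ?f ij" if "ij \<in> ?I" for ij
  proof (cases ij)
    case (Pair i j)
    with X that have "X i j \<in> carrier_mat (\<alpha> ! i + \<alpha> ! j) (\<alpha> ! i + \<alpha> ! j)" "(X i j)\<^sup>T = X i j"
      by (auto simp: psd_mats_def)
    with Pair show ?thesis
      using E_block_pair_carrier[of m \<alpha> i j, where 'a = real]
      by (auto simp: transpose_congruence simp del: assoc_mult_mat
          intro!: mult_carrier_mat[of _ _ "\<alpha> ! i + \<alpha> ! j"])
  qed
  then have "(mat_sum m m ?f ?I)\<^sup>T = mat_sum m m ?f ?I"
    by (subst transpose_mat_sum) (auto intro: mat_sum_cong)
  then show ?thesis unfolding FW2_def using X by auto
qed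

lemma poly_mats_iff:
  "M \<in> poly_mats n p q \<longleftrightarrow> M \<in> carrier_mat p q \<and> (\<forall>i<p. \<forall>j<q. M $$ (i, j) \<in> polys n)"
  by (auto simp: poly_mats_def dest!: elements_matD intro: subsetD[OF _ elements_matI])

lemma poly_mats_mult:
  "A \<in> poly_mats n p q \<Longrightarrow> B \<in> poly_mats n q k \<Longrightarrow> A * B \<in> poly_mats n p k"
  by (auto simp: poly_mats_iff scalar_prod_def intro!: polys_sum polys_mult)

lemma poly_mats_transpose: "A \<in> poly_mats n p q \<Longrightarrow> A\<^sup>T \<in> poly_mats n q p"
  by (auto simp: poly_mats_iff)

lemma poly_mats_const: "C \<in> carrier_mat p q \<Longrightarrow> map_mat const_poly C \<in> poly_mats n p q"
  by (auto simp: poly_mats_iff polys_const)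

lemma E_pair_poly_mats: "i < r \<Longrightarrow> j < r \<Longrightarrow> E_pair r i j \<in> poly_mats n 2 r"
  using polys_const[of 1 n]
  by (auto simp: poly_mats_iff E_pair_carrier E_pair_index polys_0)

lemma I_monomials_poly_mats:
  assumes "N = (n + d) choose d"
  shows "I_monomials n d p \<in> poly_mats n (p * N) p"
proof -
  have "monomial (exponents_le n d ! (a mod N)) \<in> polys n" for a
    by (intro monomial_in_polys[of _ n d] nth_mem)
      (simp add: length_exponents_le assms)
  then show ?thesis
    by (auto simp: poly_mats_iff I_monomials_carrier[OF assms] I_monomials_index[OF assms] polys_0)
qed

text \<open>Links Gram matrices to squares in both directions: \<open>C\<close> is a square factor
  of a PSD matrix in one, and the coefficient matrix of an SOS factor, with any number of rows, in
  the other.\<close>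

lemma const_gram_congruence:
  assumes "N = (n + d) choose d" "C \<in> carrier_mat s (p * N)"
  shows "(I_monomials n d p)\<^sup>T * map_mat const_poly (C\<^sup>T * C) * I_monomials n d p =
    (map_mat const_poly C * I_monomials n d p)\<^sup>T * (map_mat const_poly C * I_monomials n d p)"
proof -
  have "map_mat const_poly (C\<^sup>T * C) = (map_mat const_poly C)\<^sup>T * map_mat const_poly C"
    using assms(2) const_poly.mat_hom_mult[of "C\<^sup>T" "p * N" s C "p * N"]
    by (simp add: map_mat_transpose)
  then show ?thesis
    using congruence_gram[OF I_monomials_carrier[OF assms(1)], of "map_mat const_poly C" s p] assms(2)
    by simp
qed

lemma sos_mats_psd_congruence:
  assumes N: "N = (n + d) choose d" and X: "X \<in> psd_mats (p * N)"
  shows "(I_monomials n d p)\<^sup>T * map_mat const_poly X * I_monomials n d p \<in> sos_mats n p"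
proof -
  obtain L where L: "L \<in> carrier_mat (p * N) (p * N)" "X = L\<^sup>T * L"
    using psd_mats_gram[OF X] .
  let ?M = "map_mat const_poly L * I_monomials n d p"
  have M: "?M \<in> poly_mats n (p * N) p"
    by (rule poly_mats_mult[OF poly_mats_const[OF L(1)] I_monomials_poly_mats[OF N]])
  then have "?M\<^sup>T * ?M \<in> sos_mats n p"
    unfolding sos_mats_def using poly_mats_mult[OF poly_mats_transpose] by blast
  then show ?thesis by (simp only: L(2) const_gram_congruence[OF N L(1)])
qed

section \<open>The degree of the factors and the equivalence\<close>

lemma factor_entries_degree:
  assumes P: "P \<in> carrier_mat r r" "elements_mat P \<subseteq> polys_le n (2 * d)"
    and M: "\<And>i j. (i, j) \<in> index_pairs r \<Longrightarrow> M i j \<in> poly_mats n (s i j) 2"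
    and eq: "P = mat_sum r r (\<lambda>(i, j). (E_pair r i j)\<^sup>T * ((M i j)\<^sup>T * M i j) * E_pair r i j) (index_pairs r)"
    and ij: "(i, j) \<in> index_pairs r" and t: "t < s i j" and c: "c < 2"
  shows "M i j $$ (t, c) \<in> polys_le n d"
proof -
  \<comment> \<open>Multiplication by \<open>E_pair r i j\<close> puts the two columns of
    \<open>M i j\<close> at \<open>i\<close> and \<open>j\<close> and zeros elsewhere, so all
    factors get \<open>r\<close> columns and \<open>P\<close> becomes a plain sum of Gram
    products.\<close>
  define F where "F = (\<lambda>(i, j). M i j * E_pair r i j)"
  define S where "S = (\<lambda>(i, j). s i j)"
  have F: "F ab \<in> poly_mats n (S ab) r" if "ab \<in> index_pairs r" for ab
    using that M unfolding F_def S_def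
    by (cases ab) (auto intro!: poly_mats_mult[of _ _ _ 2] E_pair_poly_mats simp: index_pairs_def)
  have PF: "P = mat_sum r r (\<lambda>ab. (F ab)\<^sup>T * F ab) (index_pairs r)"
    unfolding eq
  proof (rule mat_sum_cong)
    fix ab assume ab: "ab \<in> index_pairs r"
    obtain a b where [simp]: "ab = (a, b)" by (cases ab)
    have "M a b \<in> carrier_mat (s a b) 2" using M ab by (simp add: poly_mats_iff)
    then show "(case ab of (i, j) \<Rightarrow> (E_pair r i j)\<^sup>T * ((M i j)\<^sup>T * M i j) * E_pair r i j) = (F ab)\<^sup>T * F ab"
      by (simp add: F_def congruence_gram[OF E_pair_carrier])
  qed
  have diag: "P $$ (k, k) = (\<Sum>ab\<in>index_pairs r. \<Sum>t<S ab. F ab $$ (t, k) * F ab $$ (t, k))"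
    if "k < r" for k
  proof -
    have "((F ab)\<^sup>T * F ab) $$ (k, k) = (\<Sum>t<S ab. F ab $$ (t, k) * F ab $$ (t, k))"
      if "ab \<in> index_pairs r" for ab
      using F[OF that] \<open>k < r\<close> by (intro gram_mat_index[of _ _ r]) (simp_all add: poly_mats_iff)
    with PF that show ?thesis by (simp cong: sum.cong)
  qed
  have F_le: "F (i, j) $$ (t, k) \<in> polys_le n d" if k: "k < r" for k
  proof -
    \<comment> \<open>A block together with a row of its factor forms a single index, because
      \<open>sum_squares_degree\<close> takes one finite family.\<close>
    let ?I = "SIGMA ab:index_pairs r. {..<S ab}"
    let ?q = "\<lambda>(ab, t). F ab $$ (t, k)"
    have "(\<Sum>x\<in>?I. ?q x * ?q x) = P $$ (k, k)"
      unfolding diag[OF k] by (subst sum.Sigma) (auto intro!: sum.cong)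
    also have "\<dots> \<in> polys_le n (2 * d)"
      using P elements_matI[OF P(1) k k refl] by blast
    finally have "?q ((i, j), t) \<in> polys_le n d"
      by (rule sum_squares_degree[rotated 2]) (use F k ij t in \<open>auto simp: poly_mats_iff S_def\<close>)
    then show ?thesis by simp
  qed
  have ij': "i < r" "j < r" "i \<noteq> j" using ij by (auto simp: index_pairs_def)
  \<comment> \<open>As \<open>i\<close> and \<open>j\<close> differ, columns \<open>i\<close> and
    \<open>j\<close> of \<open>F (i, j)\<close> are exactly columns 0 and 1 of
    \<open>M i j\<close>.\<close>
  have "M i j $$ (t, c) = F (i, j) $$ (t, if c = 0 then i else j)"
    using M[OF ij] ij' t c E_pair_carrier[of r i j, where 'a = rpoly]
    by (auto simp: F_def poly_mats_iff scalar_prod_def E_pair_index numeral_2_eq_2 less_Suc_eq)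
  also have "\<dots> \<in> polys_le n d" by (rule F_le) (use ij' in simp)
  finally show ?thesis .
qed

theorem proposition5:
  fixes n d r N :: nat and P :: "rpoly mat"
  assumes "r \<ge> 2"
    and "P \<in> carrier_mat r r" and "elements_mat P \<subseteq> polys_le n (2 * d)"
    and "N = (n + d) choose d"
  shows "(\<exists>P' :: nat \<Rightarrow> nat \<Rightarrow> rpoly mat.
            (\<forall>(i, j) \<in> index_pairs r. P' i j \<in> sos_mats n 2) \<and>
            P = mat_sum r r (\<lambda>(i, j). (E_pair r i j)\<^sup>T * P' i j * E_pair r i j) (index_pairs r))
     \<longleftrightarrow> (\<exists>Q \<in> FW2 (r * N) (replicate r N).
            P = (1\<^sub>m r \<otimes>\<^sub>K monomial_col n d)\<^sup>T * map_mat const_poly Q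
                  * (1\<^sub>m r \<otimes>\<^sub>K monomial_col n d))"
  (is "?sos \<longleftrightarrow> ?gram")
proof
  let ?S = "E_block_pair (r * N) (replicate r N)"
  note N = \<open>N = (n + d) choose d\<close>
  {
    assume ?sos
    then obtain P' where P': "\<And>i j. (i, j) \<in> index_pairs r \<Longrightarrow> P' i j \<in> sos_mats n 2"
      and P: "P = mat_sum r r (\<lambda>(i, j). (E_pair r i j)\<^sup>T * P' i j * E_pair r i j) (index_pairs r)"
      by blast
    \<comment> \<open>The number of rows of the factor may vary with the pair, so it is chosen along
      with the factor.\<close>
    have "\<forall>i j. \<exists>s M. (i, j) \<in> index_pairs r \<longrightarrow> M \<in> poly_mats n s 2 \<and> P' i j = M\<^sup>T * M"
      using P' unfolding sos_mats_def by blast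
    then obtain s M where M: "\<And>i j. (i, j) \<in> index_pairs r \<Longrightarrow> M i j \<in> poly_mats n (s i j) 2"
      and P'M: "\<And>i j. (i, j) \<in> index_pairs r \<Longrightarrow> P' i j = (M i j)\<^sup>T * M i j"
      by metis
    have PM: "P = mat_sum r r (\<lambda>(i, j). (E_pair r i j)\<^sup>T * ((M i j)\<^sup>T * M i j) * E_pair r i j)
        (index_pairs r)"
      unfolding P by (rule mat_sum_cong) (auto simp: P'M)
    have "\<exists>C \<in> carrier_mat (s i j) (2 * N). M i j = map_mat const_poly C * I_monomials n d 2"
      if "(i, j) \<in> index_pairs r" for i j
      using M[OF that] factor_entries_degree[OF assms(2,3) M PM that]
      by (meson eq_const_mult_I_monomials[OF N] poly_mats_iff)
    then obtain C where C: "\<And>i j. (i, j) \<in> index_pairs r \<Longrightarrow> C i j \<in> carrier_mat (s i j) (2 * N)"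
      and MC: "\<And>i j. (i, j) \<in> index_pairs r \<Longrightarrow> M i j = map_mat const_poly (C i j) * I_monomials n d 2"
      by metis
    \<comment> \<open>The Gram matrix of the coefficient matrix of \<open>M i j\<close>, PSD by its
      form.\<close>
    let ?X = "\<lambda>i j. (C i j)\<^sup>T * C i j"
    let ?Q = "mat_sum (r * N) (r * N) (\<lambda>(i, j). (?S i j)\<^sup>T * ?X i j * ?S i j) (index_pairs r)"
    have X: "?X i j \<in> psd_mats (2 * N)" if "(i, j) \<in> index_pairs r" for i j
      by (rule gram_in_psd_mats[OF C[OF that]])
    have "?Q \<in> FW2 (r * N) (replicate r N)"
      using mat_sum_congruence_in_FW2[of "replicate r N" ?X "r * N"] X
      by (auto simp: index_pairs_def mult_2)
    moreover have "P = (I_monomials n d r)\<^sup>T * map_mat const_poly ?Q * I_monomials n d r"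
    proof -
      have "P = mat_sum r r (\<lambda>(i, j). (E_pair r i j)\<^sup>T *
          ((I_monomials n d 2)\<^sup>T * map_mat const_poly (?X i j) * I_monomials n d 2) * E_pair r i j)
          (index_pairs r)"
        unfolding PM by (rule mat_sum_cong) (auto simp: MC const_gram_congruence[OF N C])
      also have "\<dots> = (I_monomials n d r)\<^sup>T * map_mat const_poly ?Q * I_monomials n d r"
        by (rule I_monomials_congruence_FW2_sum[OF N, symmetric]) (use X in \<open>auto simp: psd_mats_def\<close>)
      finally show ?thesis .
    qed
    ultimately show ?gram unfolding I_monomials_def by blast
  next
    assume ?gram
    then obtain X where X: "\<And>i j. (i, j) \<in> index_pairs r \<Longrightarrow> X i j \<in> psd_mats (2 * N)"
      and P: "P = (I_monomials n d r)\<^sup>T * map_mat const_poly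
        (mat_sum (r * N) (r * N) (\<lambda>(i, j). (?S i j)\<^sup>T * X i j * ?S i j) (index_pairs r)) * I_monomials n d r"
      unfolding FW2_def I_monomials_def by (auto simp: index_pairs_def mult_2)
    let ?P' = "\<lambda>i j. (I_monomials n d 2)\<^sup>T * map_mat const_poly (X i j) * I_monomials n d 2"
    have "P = mat_sum r r (\<lambda>(i, j). (E_pair r i j)\<^sup>T * ?P' i j * E_pair r i j) (index_pairs r)"
      unfolding P by (rule I_monomials_congruence_FW2_sum[OF N]) (use X in \<open>auto simp: psd_mats_def\<close>)
    moreover have "\<forall>(i, j) \<in> index_pairs r. ?P' i j \<in> sos_mats n 2"
      using sos_mats_psd_congruence[OF N X] by auto
    ultimately show ?sos by (intro exI[of _ ?P']) simp
  }
qed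

end
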